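(* If $G$ is a graph on $n$ vertices with minimum degree $\delta(G)\ge \frac{3}{4}n$, then $G$ admits a fractional $K_3$-decomposition.
   Context: Graphs are finite and simple. A fractional $K_3$-decomposition of a graph $G$ is an assignment of non-negative real weights to the copies of $K_3$ (triangles) in $G$ such that for every edge $e$ of $G$ the sum of the weights of the triangles containing $e$ is exactly $1$. *)

theory Defs
  imports Complex_Main
begin

definition fin_simple_graph :: "'a set \<Rightarrow> 'a set set \<Rightarrow> bool" where
  "fin_simple_graph V E \<longleftrightarrow> finite V \<and> (\<forall>e\<in>E. e \<subseteq> V \<and> card e = 2)"

definition vertex_degree :: "'a set set \<Rightarrow> 'a \<Rightarrow> nat" where
  "vertex_degree E v = card {e \<in> E. v \<in> e}"

(* Only meaningful for nonempty V, since Min {} is unspecified. *)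
definition min_degree :: "'a set \<Rightarrow> 'a set set \<Rightarrow> nat" where
  "min_degree V E = Min (vertex_degree E ` V)"

(* A copy of the complete graph on three vertices in a simple graph is determined
   by its vertex set, so triangles are represented as 3-element vertex sets. *)
definition triangles :: "'a set \<Rightarrow> 'a set set \<Rightarrow> 'a set set" where
  "triangles V E = {T. T \<subseteq> V \<and> card T = 3 \<and> (\<forall>x\<in>T. \<forall>y\<in>T. x \<noteq> y \<longrightarrow> {x, y} \<in> E)}"

(* Values of w outside the triangles are irrelevant. An edge lies in a triangle iff
   both its endpoints do, i.e. iff it is a subset of the triangle's vertex set. *)
definition fractional_triangle_decomposition ::
    "'a set \<Rightarrow> 'a set set \<Rightarrow> ('a set \<Rightarrow> real) \<Rightarrow> bool" where
  "fractional_triangle_decomposition V E w \<longleftrightarrow>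
     (\<forall>T\<in>triangles V E. 0 \<le> w T) \<and>
     (\<forall>e\<in>E. (\<Sum>T\<in>{T \<in> triangles V E. e \<subseteq> T}. w T) = 1)"

end

(*
  Choose weights w >= 0 on the triangles minimising the sum over the edges of r(e)^2, where
  r(e) = w(e) - 1 and w(e) is the total weight of the triangles at e. Optimality gives
  r(T) >= 0 for every triangle T and w(T) r(T) = 0, hence the sum of r is minus the sum of r^2.
  So it suffices that every edge function s with s(T) >= 0 on all triangles has sum >= 0.

  Let tau be a permutation of the vertices moving each v to a neighbour and minimising the
  sum of s(v, tau v). Duality for the assignment problem gives potentials pi with
  s(u,v) >= pi(u) + pi(v) on all edges and equality on the edges v, tau v.
  With k(v) = max(- pi(v) - pi(tau v), pi(v), pi(tau v)) >= 0, the triangle conditions and the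
  potentials show, for all u and v, that the sum of s over the edges between {v, tau v} and
  {u, tau u} is at least (k(v) + k(u)) (1 - m), where m of the four cross pairs are non-edges.
  Summing over all u and v, the minimum degree makes the average of m at most 1 for fixed v,
  so the total is nonnegative.
*)

theory Submission
  imports Defs "HOL-Analysis.Function_Topology" "HOL-Combinatorics.Cycles"
begin

section \<open>Shortest-path potentials and duality for the assignment problem\<close>

fun path_cost :: "('a \<Rightarrow> 'a \<Rightarrow> real) \<Rightarrow> 'a list \<Rightarrow> real" where
  "path_cost l (x # y # xs) = l x y + path_cost l (y # xs)"
| "path_cost l _ = 0"

lemma path_cost_append:
  "path_cost l (xs @ x # ys) = path_cost l (xs @ [x]) + path_cost l (x # ys)"
  by (induction l xs rule: path_cost.induct) (cases ys; simp)+

text \<open>Take for \<open>\<alpha> u\<close> the least cost of a simple path that starts at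
  \<open>u\<close> and ends anywhere. If \<open>u\<close> already lies on an optimal path from
  \<open>v\<close>, the part up to \<open>u\<close> closes up with the arc from \<open>u\<close> to
  \<open>v\<close> to a cycle of nonnegative cost, so it can be cut off.\<close>

lemma ex_potential:
  assumes fin: "finite V"
    and cyc: "\<And>cs. distinct cs \<Longrightarrow> cs \<noteq> [] \<Longrightarrow> set cs \<subseteq> V
      \<Longrightarrow> 0 \<le> path_cost l cs + l (last cs) (hd cs)"
  obtains \<alpha> :: "'a \<Rightarrow> real" where "\<And>u v. u \<in> V \<Longrightarrow> v \<in> V \<Longrightarrow> \<alpha> u \<le> l u v + \<alpha> v"
proof -
  define P where "P u = {p. set p \<subseteq> V \<and> distinct p \<and> p \<noteq> [] \<and> hd p = u}" for u
  define \<alpha> where "\<alpha> u = Min (path_cost l ` P u)" for u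
  have finP: "finite (P u)" for u
    by (rule finite_subset[OF _ finite_subset_distinct[OF fin]]) (auto simp: P_def)
  have le: "\<alpha> u \<le> path_cost l p" if "p \<in> P u" for u p
    using that finP by (auto simp: \<alpha>_def)
  have "\<alpha> u \<le> l u v + \<alpha> v" if u: "u \<in> V" and v: "v \<in> V" for u v
  proof -
    have "[v] \<in> P v" using v by (auto simp: P_def)
    then have "\<alpha> v \<in> path_cost l ` P v"
      unfolding \<alpha>_def using finP by (intro Min_in) auto
    then obtain p where p: "p \<in> P v" and \<alpha>v: "\<alpha> v = path_cost l p" by auto
    show ?thesis
    proof (cases "u \<in> set p")
      case False
      then have "u # p \<in> P u" using p u by (auto simp: P_def)
      moreover obtain xs where "p = v # xs" using p by (cases p) (auto simp: P_def)
      ultimately show ?thesis using le[of "u # p" u] \<alpha>v by simp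
    next
      case True
      then obtain xs ys where xy: "p = xs @ u # ys" by (meson split_list)
      have "u # ys \<in> P u" using p xy by (auto simp: P_def)
      then have "\<alpha> u \<le> path_cost l (u # ys)" by (rule le)
      moreover have "hd (xs @ [u]) = v" using p xy by (cases xs) (auto simp: P_def)
      then have "0 \<le> path_cost l (xs @ [u]) + l u v"
        using cyc[of "xs @ [u]"] p xy by (auto simp: P_def)
      ultimately show ?thesis
        using \<alpha>v path_cost_append[of l xs u ys] xy by simp
    qed
  qed
  then show ?thesis by (rule that)
qed

lemma path_cost_closed:
  "path_cost l (x # xs) + l (last (x # xs)) z = sum_list (map2 l (x # xs) (xs @ [z]))"
  by (induction xs arbitrary: x) auto

lemma sum_cycle_of_list:
  assumes "distinct cs" "cs \<noteq> []"
  shows "(\<Sum>v\<in>set cs. l v (cycle_of_list cs v)) = path_cost l cs + l (last cs) (hd cs)"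
proof -
  have "map (cycle_of_list cs) cs = rotate1 cs"
    using cyclic_rotation[OF assms(1), of 1] by simp
  then have "map2 l cs (rotate1 cs) = map2 l cs (map (cycle_of_list cs) cs)" by simp
  also have "\<dots> = map (\<lambda>v. l v (cycle_of_list cs v)) cs"
    by (simp add: zip_map2 zip_same_conv_map)
  finally have "(\<Sum>v\<in>set cs. l v (cycle_of_list cs v)) = sum_list (map2 l cs (rotate1 cs))"
    using assms(1) by (simp add: sum_list_distinct_conv_sum_set)
  also obtain x xs where "cs = x # xs" using assms(2) by (cases cs) auto
  then have "sum_list (map2 l cs (rotate1 cs)) = path_cost l cs + l (last cs) (hd cs)"
    using path_cost_closed[of l x xs x] by simp
  finally show ?thesis .
qed

lemma assignment_duality:
  fixes c :: "'a \<Rightarrow> 'a \<Rightarrow> real"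
  assumes fin: "finite V" and \<tau>: "\<tau> permutes V"
    and min: "\<And>\<sigma>. \<sigma> permutes V \<Longrightarrow> (\<Sum>v\<in>V. c v (\<tau> v)) \<le> (\<Sum>v\<in>V. c v (\<sigma> v))"
  obtains \<alpha> \<beta> :: "'a \<Rightarrow> real"
  where "\<And>u v. u \<in> V \<Longrightarrow> v \<in> V \<Longrightarrow> \<alpha> u + \<beta> v \<le> c u v"
    and "\<And>u. u \<in> V \<Longrightarrow> \<alpha> u + \<beta> (\<tau> u) = c u (\<tau> u)"
proof -
  \<comment> \<open>\<open>l u v\<close> compares what \<open>u\<close> and \<open>v\<close> pay for
    the image of \<open>v\<close>. A cycle of such takeovers yields another permutation, so
    minimality of \<open>\<tau>\<close> excludes negative cycles.\<close>
  define l where "l u v = c u (\<tau> v) - c v (\<tau> v)" for u v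
  have "0 \<le> path_cost l cs + l (last cs) (hd cs)"
    if cs: "distinct cs" "cs \<noteq> []" "set cs \<subseteq> V" for cs
  proof -
    let ?\<sigma> = "cycle_of_list cs"
    have \<sigma>: "?\<sigma> permutes set cs" by (rule cycle_permutes)
    then have \<sigma>V: "?\<sigma> permutes V" using cs(3) by (rule permutes_subset)
    have "0 \<le> (\<Sum>v\<in>V. c v (\<tau> (?\<sigma> v)) - c v (\<tau> v))"
      using min[OF permutes_compose[OF \<sigma>V \<tau>]] by (simp add: sum_subtractf)
    also have "\<dots> = (\<Sum>v\<in>set cs. c v (\<tau> (?\<sigma> v)) - c v (\<tau> v))"
      using fin cs(3) permutes_not_in[OF \<sigma>] by (intro sum.mono_neutral_right) auto
    also have "\<dots> = (\<Sum>v\<in>set cs. l v (?\<sigma> v))"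
      using sum.permute[OF \<sigma>, of "\<lambda>v. c v (\<tau> v)"] by (simp add: l_def sum_subtractf o_def)
    finally show ?thesis using sum_cycle_of_list[OF cs(1,2), of l] by simp
  qed
  from ex_potential[OF fin this] obtain \<alpha>
    where \<alpha>: "\<And>u v. u \<in> V \<Longrightarrow> v \<in> V \<Longrightarrow> \<alpha> u \<le> l u v + \<alpha> v" by blast
  \<comment> \<open>Equality along \<open>\<tau>\<close> forces this value; the bound at
    \<open>u\<close> and \<open>v\<close> is then the potential inequality between \<open>u\<close>
    and \<open>inv \<tau> v\<close>.\<close>
  define \<beta> where "\<beta> v = c (inv \<tau> v) v - \<alpha> (inv \<tau> v)" for v
  show ?thesis
  proof
    show "\<alpha> u + \<beta> v \<le> c u v" if "u \<in> V" "v \<in> V" for u v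
      using \<alpha>[of u "inv \<tau> v"] that permutes_inverses[OF \<tau>] permutes_in_image[OF permutes_inv[OF \<tau>], of v]
      by (simp add: \<beta>_def l_def)
    show "\<alpha> u + \<beta> (\<tau> u) = c u (\<tau> u)" if "u \<in> V" for u
      by (simp add: \<beta>_def permutes_inverses[OF \<tau>])
  qed
qed


section \<open>Permutations along edges and the sign of edge sums\<close>

text \<open>
  Here \<open>rx, ry, rz, rw\<close> are the negated potentials of two matched pairs \<open>{x, y}\<close> and \<open>{z, w}\<close>, the
  Booleans tell which cross pairs are edges, and \<open>a, b, c, d\<close> are the values of \<open>s\<close> on those edges.
\<close>

lemma cross_sum_ge:
  fixes k l rx ry rz rw a b c d :: real
  assumes k: "k = max (rx + ry) (max (- rx) (- ry))" and l: "l = max (rz + rw) (max (- rz) (- rw))"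
    and "axz \<Longrightarrow> a \<ge> - (rx + rz)" and "axw \<Longrightarrow> b \<ge> - (rx + rw)"
    and "ayz \<Longrightarrow> c \<ge> - (ry + rz)" and "ayw \<Longrightarrow> d \<ge> - (ry + rw)"
    and "axz \<Longrightarrow> ayz \<Longrightarrow> a + c \<ge> rx + ry"
    and "axw \<Longrightarrow> ayw \<Longrightarrow> b + d \<ge> rx + ry"
    and "axz \<Longrightarrow> axw \<Longrightarrow> a + b \<ge> rz + rw"
    and "ayz \<Longrightarrow> ayw \<Longrightarrow> c + d \<ge> rz + rw"
  shows "(k + l) * (1 - of_bool (\<not> axz) - of_bool (\<not> axw) - of_bool (\<not> ayz) - of_bool (\<not> ayw))
    \<le> (if axz then a else 0) + (if axw then b else 0) + (if ayz then c else 0) + (if ayw then d else 0)"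
proof -
  have K: "k \<ge> rx + ry" "k \<ge> - rx" "k \<ge> - ry" "k = rx + ry \<or> k = - rx \<or> k = - ry"
    and L: "l \<ge> rz + rw" "l \<ge> - rz" "l \<ge> - rw" "l = rz + rw \<or> l = - rz \<or> l = - rw"
    unfolding k l by linarith+
  \<comment> \<open>If all four cross pairs are edges, the sum is at least \<open>2 * k\<close> and
    at least \<open>2 * l\<close>. If one is missing, two lower bounds for the sum average to
    \<open>0\<close>. With fewer edges the right-hand side is nonpositive, and bounds such as
    \<open>- k \<le> rx\<close> and \<open>rx \<le> 2 * k\<close> come in.\<close>
  show ?thesis
    using assms(3-) K(1-3) L(1-3)
    by (cases axz; cases axw; cases ayz; cases ayw; simp) (use K(4) L(4) in linarith)+
qed

text \<open>Degrees above half of \<open>card V\<close> make a cheapest permutation run along edges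
  only. Its dual potentials \<open>\<alpha>\<close> and \<open>\<beta>\<close> can be averaged into
  a single \<open>\<pi>\<close> because \<open>adj\<close> and \<open>s\<close> are
  symmetric.\<close>

lemma tight_permutation:
  fixes s :: "'a \<Rightarrow> 'a \<Rightarrow> real"
  assumes fin: "finite V"
    and adj_sym: "\<And>u v. adj u v \<Longrightarrow> adj v u"
    and s_sym: "\<And>u v. s u v = s v u"
    and deg: "\<And>v. v \<in> V \<Longrightarrow> card V < 2 * card {u \<in> V. adj v u}"
  obtains \<tau> and \<pi> :: "'a \<Rightarrow> real"
  where "\<tau> permutes V"
    and "\<And>v. v \<in> V \<Longrightarrow> adj v (\<tau> v)"
    and "\<And>v. v \<in> V \<Longrightarrow> s v (\<tau> v) = \<pi> v + \<pi> (\<tau> v)"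
    and "\<And>u v. u \<in> V \<Longrightarrow> v \<in> V \<Longrightarrow> adj u v \<Longrightarrow> \<pi> u + \<pi> v \<le> s u v"
proof -
  define S where "S = (\<Sum>u\<in>V. \<Sum>v\<in>V. \<bar>s u v\<bar>)"
  have S: "\<bar>s u v\<bar> \<le> S" if "u \<in> V" "v \<in> V" for u v
  proof -
    have "\<bar>s u v\<bar> \<le> (\<Sum>v\<in>V. \<bar>s u v\<bar>)" using fin that by (intro member_le_sum) auto
    also have "\<dots> \<le> S" unfolding S_def using fin that
      by (intro member_le_sum[where f = "\<lambda>u. \<Sum>v\<in>V. \<bar>s u v\<bar>"]) (auto intro: sum_nonneg)
    finally show ?thesis .
  qed
  \<comment> \<open>Non-edges are so expensive that one swap always improves a permutation that uses one.\<close>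
  define c where "c u v = (if adj u v then s u v else 3 * S + 1)" for u v
  define cost where "cost \<sigma> = (\<Sum>v\<in>V. c v (\<sigma> v))" for \<sigma>
  have "finite {\<sigma>. \<sigma> permutes V}" "id \<in> {\<sigma>. \<sigma> permutes V}"
    using fin by (auto simp: finite_permutations permutes_id)
  then obtain \<tau> where \<tau>: "\<tau> permutes V"
    and min: "\<And>\<sigma>. \<sigma> permutes V \<Longrightarrow> cost \<tau> \<le> cost \<sigma>"
    using ex_is_arg_min_if_finite[of "{\<sigma>. \<sigma> permutes V}" cost]
    by (fastforce simp: is_arg_min_linorder)
  have adj_\<tau>: "adj v (\<tau> v)" if v: "v \<in> V" for v
  proof (rule ccontr)
    assume nadj: "\<not> adj v (\<tau> v)"
    have \<tau>v: "\<tau> v \<in> V" using \<tau> v by (simp add: permutes_in_image)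
    \<comment> \<open>The vertices whose image \<open>v\<close> could take, and those that could
      move to \<open>\<tau> v\<close>: both sets exceed half of \<open>V\<close>, so some
      \<open>u\<close> lies in both and can swap images with \<open>v\<close>.\<close>
    let ?A = "{u \<in> V. adj v (\<tau> u)}" and ?B = "{u \<in> V. adj (\<tau> v) u}"
    have "\<tau> ` ?A = {u \<in> \<tau> ` V. adj v u}" by auto
    then have "\<tau> ` ?A = {u \<in> V. adj v u}" by (simp add: permutes_image[OF \<tau>])
    then have "card ?A = card {u \<in> V. adj v u}"
      by (metis (no_types, lifting) \<tau> card_image permutes_inj_on)
    then have "card V < card ?A + card ?B" using deg[OF v] deg[OF \<tau>v] by linarith
    moreover have "card (?A \<union> ?B) \<le> card V" using fin by (intro card_mono) auto
    ultimately have "card (?A \<inter> ?B) > 0"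
      using card_Un_Int[of ?A ?B] fin by simp
    then obtain u where u: "u \<in> V" "adj v (\<tau> u)" "adj u (\<tau> v)"
      using adj_sym by (force simp: card_gt_0_iff)
    have uv: "u \<noteq> v" using u nadj by auto
    have \<tau>u: "\<tau> u \<in> V" using \<tau> u by (simp add: permutes_in_image)
    let ?\<sigma> = "\<tau> \<circ> transpose u v"
    have \<sigma>: "?\<sigma> permutes V"
      using permutes_compose[OF permutes_swap_id[OF u(1) v] \<tau>] .
    have split: "sum f V = f u + (f v + sum f (V - {u} - {v}))" for f :: "'a \<Rightarrow> real"
      using fin u(1) v uv by (simp add: sum.remove[of V u] sum.remove[of "V - {u}" v])
    have rest: "(\<Sum>w\<in>V - {u} - {v}. c w (?\<sigma> w)) = (\<Sum>w\<in>V - {u} - {v}. c w (\<tau> w))"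
      by (intro sum.cong) (auto simp: transpose_apply_other)
    have "c u (\<tau> u) + c v (\<tau> v) \<le> c u (\<tau> v) + c v (\<tau> u)"
      using min[OF \<sigma>] unfolding cost_def
      unfolding split[of "\<lambda>w. c w (?\<sigma> w)"] split[of "\<lambda>w. c w (\<tau> w)"] rest by simp
    \<comment> \<open>Since \<open>S \<ge> 0\<close>, this holds for non-edges too. The old pair
      thus costs at least \<open>2 * S + 1\<close>, the swapped pair at most
      \<open>2 * S\<close>.\<close>
    moreover have "c u (\<tau> u) \<ge> - S"
      using S[OF u(1) \<tau>u] S[OF v \<tau>v] by (auto simp: c_def)
    moreover have "c v (\<tau> v) = 3 * S + 1" using nadj by (simp add: c_def)
    moreover have "c u (\<tau> v) \<le> S" "c v (\<tau> u) \<le> S"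
      using S[OF u(1) \<tau>v] S[OF v \<tau>u] u by (auto simp: c_def)
    ultimately show False by linarith
  qed
  from assignment_duality[OF fin \<tau>, of c] min obtain \<alpha> \<beta>
    where ub: "\<And>u v. u \<in> V \<Longrightarrow> v \<in> V \<Longrightarrow> \<alpha> u + \<beta> v \<le> c u v"
      and eq: "\<And>u. u \<in> V \<Longrightarrow> \<alpha> u + \<beta> (\<tau> u) = c u (\<tau> u)"
    unfolding cost_def by blast
  define \<pi> where "\<pi> v = (\<alpha> v + \<beta> v) / 2" for v
  have le: "\<pi> u + \<pi> v \<le> s u v" if "u \<in> V" "v \<in> V" "adj u v" for u v
    using ub[of u v] ub[of v u] that adj_sym[of u v] s_sym[of u v]
    by (simp add: \<pi>_def c_def field_simps)
  \<comment> \<open>Both sides of \<open>le\<close> have the same total along \<open>\<tau>\<close>, so it is an equality there.\<close>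
  have "(\<Sum>v\<in>V. s v (\<tau> v)) = (\<Sum>v\<in>V. \<alpha> v + \<beta> (\<tau> v))"
    using eq adj_\<tau> by (intro sum.cong) (auto simp: c_def)
  also have "\<dots> = (\<Sum>v\<in>V. \<alpha> v) + (\<Sum>v\<in>V. \<beta> v)"
    using sum.permute[OF \<tau>, of \<beta>] by (simp add: sum.distrib o_def)
  also have "\<dots> = (\<Sum>v\<in>V. \<pi> v) + (\<Sum>v\<in>V. \<pi> v)"
    by (simp add: \<pi>_def sum.distrib flip: sum_divide_distrib)
  also have "\<dots> = (\<Sum>v\<in>V. \<pi> v + \<pi> (\<tau> v))"
    using sum.permute[OF \<tau>, of \<pi>] by (simp add: sum.distrib o_def)
  finally have "(\<Sum>v\<in>V. s v (\<tau> v) - (\<pi> v + \<pi> (\<tau> v))) = 0"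
    by (simp add: sum_subtractf)
  moreover have "0 \<le> s v (\<tau> v) - (\<pi> v + \<pi> (\<tau> v))" if "v \<in> V" for v
    using le[OF that _ adj_\<tau>[OF that]] \<tau> that by (simp add: permutes_in_image)
  ultimately have "s v (\<tau> v) = \<pi> v + \<pi> (\<tau> v)" if "v \<in> V" for v
    using sum_nonneg_eq_0_iff[OF fin, of "\<lambda>v. s v (\<tau> v) - (\<pi> v + \<pi> (\<tau> v))"] that by auto
  then show ?thesis using that \<tau> adj_\<tau> le by blast
qed

text \<open>This is the condition that linear programming duality pairs with the existence of a
  fractional decomposition. The sum runs over ordered pairs, so it counts every edge twice.\<close>

lemma sum_edges_nonneg:
  fixes s :: "'a \<Rightarrow> 'a \<Rightarrow> real"
  assumes fin: "finite V"
    and irrefl: "\<And>v. \<not> adj v v"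
    and adj_sym: "\<And>u v. adj u v \<Longrightarrow> adj v u"
    and s_sym: "\<And>u v. s u v = s v u"
    and deg: "\<And>v. v \<in> V \<Longrightarrow> 3 * card V \<le> 4 * card {u \<in> V. adj v u}"
    and tri: "\<And>x y z. {x, y, z} \<subseteq> V \<Longrightarrow> adj x y \<Longrightarrow> adj y z \<Longrightarrow> adj x z
      \<Longrightarrow> 0 \<le> s x y + s y z + s x z"
  shows "0 \<le> (\<Sum>u\<in>V. \<Sum>v\<in>V. if adj u v then s u v else 0)"
proof -
  have "card V < 2 * card {u \<in> V. adj v u}" if "v \<in> V" for v
  proof -
    have "card V > 0" using fin that by (auto simp: card_gt_0_iff)
    then show ?thesis using deg[OF that] by linarith
  qed
  from tight_permutation[where adj = adj and s = s, OF fin adj_sym s_sym this] obtain \<tau> \<pi>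
    where \<tau>: "\<tau> permutes V" and adj_\<tau>: "\<And>v. v \<in> V \<Longrightarrow> adj v (\<tau> v)"
      and eq: "\<And>v. v \<in> V \<Longrightarrow> s v (\<tau> v) = \<pi> v + \<pi> (\<tau> v)"
      and le: "\<And>u v. u \<in> V \<Longrightarrow> v \<in> V \<Longrightarrow> adj u v \<Longrightarrow> \<pi> u + \<pi> v \<le> s u v" by blast
  have \<tau>V: "\<tau> v \<in> V" if "v \<in> V" for v using \<tau> that by (simp add: permutes_in_image)
  \<comment> \<open>The three numbers add up to \<open>0\<close>, so their maximum is
    nonnegative.\<close>
  define k where "k v = max (- \<pi> v - \<pi> (\<tau> v)) (max (\<pi> v) (\<pi> (\<tau> v)))" for v
  have k: "0 \<le> k v" for v unfolding k_def by linarith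
  define e where "e u v = (if adj u v then s u v else 0)" for u v
  define m :: "'a \<Rightarrow> 'a \<Rightarrow> real" where "m u v = of_bool (\<not> adj u v)" for u v
  have m_sym: "m u v = m v u" for u v using adj_sym by (auto simp: m_def)
  define C where "C v u = 1 - m v u - m v (\<tau> u) - m (\<tau> v) u - m (\<tau> v) (\<tau> u)" for u v
  \<comment> \<open>\<open>\<tau>\<close> need not be an involution, and the two pairs may overlap
    or coincide; the bound holds even then, so \<open>v\<close> and \<open>u\<close> range
    independently over \<open>V\<close>.\<close>
  have cross: "(k v + k u) * C v u \<le> e v u + e v (\<tau> u) + e (\<tau> v) u + e (\<tau> v) (\<tau> u)"
    if v: "v \<in> V" and u: "u \<in> V" for v u
    unfolding C_def e_def m_def
  proof (rule cross_sum_ge[where rx = "- \<pi> v" and ry = "- \<pi> (\<tau> v)" and rz = "- \<pi> u" and rw = "- \<pi> (\<tau> u)"])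
    note V = u v \<tau>V[OF u] \<tau>V[OF v]
    note A = adj_\<tau>[OF u] adj_\<tau>[OF v]
    show "s v u + s (\<tau> v) u \<ge> - \<pi> v + - \<pi> (\<tau> v)" if "adj v u" "adj (\<tau> v) u"
      using tri[of v "\<tau> v" u] that A V eq[OF v] by simp
    show "s v (\<tau> u) + s (\<tau> v) (\<tau> u) \<ge> - \<pi> v + - \<pi> (\<tau> v)" if "adj v (\<tau> u)" "adj (\<tau> v) (\<tau> u)"
      using tri[of v "\<tau> v" "\<tau> u"] that A V eq[OF v] by simp
    show "s v u + s v (\<tau> u) \<ge> - \<pi> u + - \<pi> (\<tau> u)" if "adj v u" "adj v (\<tau> u)"
      using tri[of v u "\<tau> u"] that A V eq[OF u] by simp
    show "s (\<tau> v) u + s (\<tau> v) (\<tau> u) \<ge> - \<pi> u + - \<pi> (\<tau> u)" if "adj (\<tau> v) u" "adj (\<tau> v) (\<tau> u)"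
      using tri[of "\<tau> v" u "\<tau> u"] that A V eq[OF u] by simp
  qed (use le[OF v u] le[OF v \<tau>V[OF u]] le[OF \<tau>V[OF v] u] le[OF \<tau>V[OF v] \<tau>V[OF u]]
      in \<open>auto simp: k_def\<close>)
  have perm: "(\<Sum>v\<in>V. f (\<tau> v)) = (\<Sum>v\<in>V. f v)" for f :: "'a \<Rightarrow> real"
    using sum.permute[OF \<tau>, of f] by (simp add: o_def)
  have C_sym: "C v u = C u v" for u v
    using m_sym[of v u] m_sym[of v "\<tau> u"] m_sym[of "\<tau> v" u] m_sym[of "\<tau> v" "\<tau> u"] by (simp add: C_def)
  \<comment> \<open>The non-neighbours of \<open>v\<close>, with \<open>v\<close> itself among them,
    form at most a quarter of \<open>V\<close>.\<close>
  have m_sum: "4 * (\<Sum>u\<in>V. m v u) \<le> card V" if "v \<in> V" for v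
  proof -
    have "(\<Sum>u\<in>V. m v u) = (\<Sum>u\<in>V. 1 - (if adj v u then 1 else 0))"
      by (intro sum.cong) (auto simp: m_def)
    also have "\<dots> = real (card V) - (\<Sum>u\<in>{u \<in> V. adj v u}. 1)"
      unfolding sum.inter_filter[OF fin] by (simp add: sum_subtractf)
    also have "\<dots> = real (card V) - card {u \<in> V. adj v u}" by simp
    finally show ?thesis using deg[OF that] by linarith
  qed
  have C_sum: "0 \<le> (\<Sum>u\<in>V. C v u)" if "v \<in> V" for v
  proof -
    \<comment> \<open>Each of the four non-edge counts is at most a quarter of
      \<open>card V\<close>, so the degree constant 3/4 is used in full here.\<close>
    have "(\<Sum>u\<in>V. C v u) = card V - 2 * (\<Sum>u\<in>V. m v u) - 2 * (\<Sum>u\<in>V. m (\<tau> v) u)"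
      using perm[of "m v"] perm[of "m (\<tau> v)"] by (simp add: C_def sum_subtractf)
    then show ?thesis using m_sum[OF that] m_sum[OF \<tau>V[OF that]] by linarith
  qed
  have "0 \<le> (\<Sum>v\<in>V. k v * (\<Sum>u\<in>V. C v u))"
    using k C_sum by (simp add: sum_nonneg)
  then have 1: "0 \<le> (\<Sum>v\<in>V. \<Sum>u\<in>V. k v * C v u)"
    by (simp add: sum_distrib_left)
  also have "\<dots> = (\<Sum>v\<in>V. \<Sum>u\<in>V. k u * C v u)"
    by (subst sum.swap) (simp add: C_sym)
  finally have "0 \<le> (\<Sum>v\<in>V. \<Sum>u\<in>V. (k v + k u) * C v u)"
    using 1 by (simp add: sum.distrib distrib_right)
  also have "\<dots> \<le> (\<Sum>v\<in>V. \<Sum>u\<in>V. e v u + e v (\<tau> u) + e (\<tau> v) u + e (\<tau> v) (\<tau> u))"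
    using cross by (intro sum_mono)
  also have "\<dots> = 4 * (\<Sum>v\<in>V. \<Sum>u\<in>V. e v u)"
    using perm[of "e _"] perm[of "\<lambda>v. \<Sum>u\<in>V. e v u"] by (simp add: sum.distrib flip: sum_distrib_left)
  finally show ?thesis by (simp add: e_def)
qed

section \<open>Least squares with nonnegative weights\<close>

text \<open>The last two conclusions are the optimality conditions for minimising the sum of squared
  residuals: no partial derivative is negative, and it vanishes where the weight is positive. By
  \<open>cov\<close> a large weight forces a large residual, so minimising over a bounded box
  suffices.\<close>

lemma ex_nonneg_least_squares:
  fixes inc :: "'e \<Rightarrow> 't \<Rightarrow> bool"
  assumes finE: "finite E" and finT: "finite T"
    and cov: "\<And>t. t \<in> T \<Longrightarrow> \<exists>e\<in>E. inc e t"
  obtains w :: "'t \<Rightarrow> real" and r :: "'e \<Rightarrow> real"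
  where "\<And>e. r e = (\<Sum>t\<in>{t \<in> T. inc e t}. w t) - 1"
    and "\<And>t. t \<in> T \<Longrightarrow> 0 \<le> w t"
    and "\<And>t. t \<in> T \<Longrightarrow> 0 \<le> (\<Sum>e\<in>{e \<in> E. inc e t}. r e)"
    and "\<And>t. t \<in> T \<Longrightarrow> w t * (\<Sum>e\<in>{e \<in> E. inc e t}. r e) = 0"
proof -
  define r where "r w e = (\<Sum>t\<in>{t \<in> T. inc e t}. w t) - 1" for w :: "'t \<Rightarrow> real" and e
  define f where "f w = (\<Sum>e\<in>E. (r w e)\<^sup>2)" for w
  define K where "K = 2 + real (card E)"
  \<comment> \<open>Weights outside \<open>T\<close> are pinned to \<open>0\<close>, so the box is a
    product of compact sets in the full function space.\<close>
  define B where "B = (\<Pi>\<^sub>E t\<in>UNIV. if t \<in> T then {0..K} else {0})"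
  have B_iff: "w \<in> B \<longleftrightarrow> (\<forall>t. if t \<in> T then 0 \<le> w t \<and> w t \<le> K else w t = 0)" for w
    unfolding B_def PiE_iff by (auto split: if_splits)
  have "compactin (product_topology (\<lambda>_. euclidean) UNIV) B"
    unfolding B_def by (subst compactin_PiE) auto
  then have "compact B" by (simp add: euclidean_product_topology)
  moreover have "(\<lambda>_. 0) \<in> B" by (auto simp: B_iff K_def)
  moreover have "continuous_on B f"
    unfolding f_def r_def
    by (intro continuous_intros continuous_on_subset[OF continuous_on_product_coordinates subset_UNIV])
  ultimately obtain w where w: "w \<in> B" and min: "\<And>w'. w' \<in> B \<Longrightarrow> f w \<le> f w'"
    using continuous_attains_inf[of B f] by blast
  have w0: "0 \<le> w t" if "t \<in> T" for t using w that by (meson B_iff)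
  \<comment> \<open>The upper bound only serves compactness; it is not attained, as \<open>f w \<le> f 0 = card E\<close>.\<close>
  have wK: "w t < K" if t: "t \<in> T" for t
  proof (rule ccontr)
    assume "\<not> w t < K"
    obtain e where e: "e \<in> E" "inc e t" using cov t by blast
    have "w t \<le> (\<Sum>t\<in>{t \<in> T. inc e t}. w t)"
      using finT t e w0 by (intro member_le_sum) auto
    then have re: "1 + real (card E) \<le> r w e" using \<open>\<not> w t < K\<close> by (simp add: r_def K_def)
    have "real (card E) < (1 + real (card E))\<^sup>2" by (simp add: power2_eq_square algebra_simps add_pos_nonneg)
    also have "\<dots> \<le> (r w e)\<^sup>2" using re by (intro power_mono) auto
    also have "\<dots> \<le> f w" unfolding f_def using finE e by (intro member_le_sum) auto
    also have "\<dots> \<le> f (\<lambda>_. 0)" by (rule min) fact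
    also have "\<dots> = card E" by (simp add: f_def r_def)
    finally show False by simp
  qed
  define G where "G t = (\<Sum>e\<in>{e \<in> E. inc e t}. r w e)" for t
  \<comment> \<open>\<open>2 * G t\<close> is the partial derivative of \<open>f\<close> at
    \<open>t\<close>; the quadratic coefficient counts the \<open>e\<close> incident with
    \<open>t\<close> and is bounded by \<open>card E\<close>.\<close>
  have step: "0 \<le> \<epsilon> * (2 * G t + \<epsilon> * card E)"
    if t: "t \<in> T" and \<epsilon>: "- w t \<le> \<epsilon>" "\<epsilon> \<le> K - w t" for t \<epsilon>
  proof -
    let ?w = "w(t := w t + \<epsilon>)"
    have "?w \<in> B" using w \<epsilon> t by (auto simp: B_iff)
    then have "f w \<le> f ?w" by (rule min)
    also have "f ?w = (\<Sum>e\<in>E. (r w e + \<epsilon> * of_bool (inc e t))\<^sup>2)"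
      unfolding f_def
    proof (intro sum.cong refl arg_cong[where f = "\<lambda>x. x\<^sup>2"])
      fix e
      have "?w = (\<lambda>t'. w t' + (if t' = t then \<epsilon> else 0))" by auto
      then show "r ?w e = r w e + \<epsilon> * of_bool (inc e t)"
        using finT t by (simp add: r_def sum.distrib)
    qed
    also have "\<dots> = (\<Sum>e\<in>E. (r w e)\<^sup>2 + (if inc e t then 2 * \<epsilon> * r w e + \<epsilon>\<^sup>2 else 0))"
      by (intro sum.cong) (auto simp: power2_sum)
    also have "\<dots> = f w + (\<Sum>e\<in>{e \<in> E. inc e t}. 2 * \<epsilon> * r w e + \<epsilon>\<^sup>2)"
      using finE by (simp add: f_def sum.distrib[of "\<lambda>e. (r w e)\<^sup>2"] sum.inter_filter)
    also have "(\<Sum>e\<in>{e \<in> E. inc e t}. 2 * \<epsilon> * r w e + \<epsilon>\<^sup>2) = 2 * \<epsilon> * G t + card {e \<in> E. inc e t} * \<epsilon>\<^sup>2"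
      by (simp add: G_def sum.distrib sum_distrib_left)
    also have "\<dots> \<le> 2 * \<epsilon> * G t + card E * \<epsilon>\<^sup>2"
      using finE by (intro add_left_mono mult_right_mono) (auto intro: card_mono)
    finally show ?thesis by (simp add: algebra_simps power2_eq_square)
  qed
  have G0: "0 \<le> G t" if t: "t \<in> T" for t
  proof (rule ccontr)
    assume G: "\<not> 0 \<le> G t"
    \<comment> \<open>This increase stays in the box, and the quadratic term offsets at most half of
      the linear decrease.\<close>
    define \<epsilon> where "\<epsilon> = min (K - w t) (- G t / K)"
    have "K > 0" by (simp add: K_def add_pos_nonneg)
    then have \<epsilon>: "0 < \<epsilon>" using wK[OF t] G by (simp add: \<epsilon>_def divide_neg_pos)
    have "\<epsilon> * card E \<le> \<epsilon> * K" using \<epsilon> by (simp add: K_def)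
    also have "\<dots> \<le> - G t" using \<open>K > 0\<close> by (simp add: \<epsilon>_def min_def field_simps)
    finally have "2 * G t + \<epsilon> * card E < 0" using G by linarith
    moreover have "0 \<le> \<epsilon> * (2 * G t + \<epsilon> * card E)"
      using step[OF t, of \<epsilon>] \<epsilon> w0[OF t] by (auto simp: \<epsilon>_def)
    ultimately show False using \<epsilon> by (simp add: zero_le_mult_iff)
  qed
  have "w t * G t = 0" if t: "t \<in> T" for t
  proof (rule ccontr)
    assume "w t * G t \<noteq> 0"
    then have G: "0 < G t" and wt: "0 < w t" using G0[OF t] w0[OF t] by (auto simp: less_le)
    \<comment> \<open>The mirror image: the weight at \<open>t\<close> is lowered by
      \<open>\<epsilon>\<close>, which \<open>0 < w t\<close> permits.\<close>
    define \<epsilon> where "\<epsilon> = min (w t) (G t / K)"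
    have "K > 0" by (simp add: K_def add_pos_nonneg)
    then have \<epsilon>: "0 < \<epsilon>" using wt G by (simp add: \<epsilon>_def)
    have "\<epsilon> * card E \<le> \<epsilon> * K" using \<epsilon> by (simp add: K_def)
    also have "\<dots> \<le> G t" using \<open>K > 0\<close> by (simp add: \<epsilon>_def min_def field_simps)
    finally have "0 < 2 * G t + - \<epsilon> * card E" using G by simp
    then have "0 < \<epsilon> * (2 * G t + - \<epsilon> * card E)" using \<epsilon> by (rule mult_pos_pos[rotated])
    moreover have "0 \<le> - \<epsilon> * (2 * G t + - \<epsilon> * card E)"
      using \<epsilon> wK[OF t] by (intro step[OF t]) (auto simp: \<epsilon>_def)
    ultimately show False by simp
  qed
  then show ?thesis
    using that[of "r w" w] w0 G0 by (simp add: r_def G_def)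
qed

section \<open>Application to the triangles of the graph\<close>

lemma sum_incident_edges:
  assumes E: "fin_simple_graph V E"
  shows "(\<Sum>e\<in>{e \<in> E. v \<in> e}. f e) = (\<Sum>u\<in>{u \<in> V. {v, u} \<in> E}. f {v, u})"
proof (rule sum.reindex_bij_betw[symmetric])
  have c2: "card e = 2" "e \<subseteq> V" if "e \<in> E" for e
    using E that by (auto simp: fin_simple_graph_def)
  show "bij_betw (\<lambda>u. {v, u}) {u \<in> V. {v, u} \<in> E} {e \<in> E. v \<in> e}"
  proof (rule bij_betw_imageI)
    show "inj_on (\<lambda>u. {v, u}) {u \<in> V. {v, u} \<in> E}"
      by (auto simp: inj_on_def doubleton_eq_iff)
    show "(\<lambda>u. {v, u}) ` {u \<in> V. {v, u} \<in> E} = {e \<in> E. v \<in> e}"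
    proof (intro equalityI subsetI)
      fix e assume e: "e \<in> {e \<in> E. v \<in> e}"
      then obtain a b where ab: "e = {a, b}" using c2(1)[of e] by (auto simp: card_2_iff)
      then obtain u where "e = {v, u}" using e by auto
      with e c2(2)[of e] show "e \<in> (\<lambda>u. {v, u}) ` {u \<in> V. {v, u} \<in> E}" by auto
    qed auto
  qed
qed

theorem theorem1p4:
  fixes V :: "'a set" and E :: "'a set set" and n :: nat
  assumes "fin_simple_graph V E"
    and "card V = n"
    and "real (min_degree V E) \<ge> 3 / 4 * real n"
  shows "\<exists>w :: 'a set \<Rightarrow> real. fractional_triangle_decomposition V E w"
proof -
  have finV: "finite V" and EV: "\<And>e. e \<in> E \<Longrightarrow> e \<subseteq> V" and card_e: "\<And>e. e \<in> E \<Longrightarrow> card e = 2"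
    using assms(1) by (auto simp: fin_simple_graph_def)
  have finE: "finite E" by (rule finite_subset[of E "Pow V"]) (use finV EV in auto)
  have fin_tri: "finite (triangles V E)" using finV by (simp add: triangles_def)
  have tri_edges: "{e \<in> E. e \<subseteq> {x, y, z}} = {{x, y}, {y, z}, {x, z}}"
    if "{x, y} \<in> E" "{y, z} \<in> E" "{x, z} \<in> E" for x y z
  proof (intro equalityI subsetI)
    fix e assume e: "e \<in> {e \<in> E. e \<subseteq> {x, y, z}}"
    then obtain a b where "e = {a, b}" "a \<noteq> b" using card_e[of e] by (auto simp: card_2_iff)
    moreover from this have "a \<in> {x, y, z}" "b \<in> {x, y, z}" using e by auto
    ultimately have "e = {x, y} \<or> e = {y, z} \<or> e = {x, z}" by (auto simp: doubleton_eq_iff)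
    then show "e \<in> {{x, y}, {y, z}, {x, z}}" by simp
  qed (use that in auto)
  have cov: "\<exists>e\<in>E. e \<subseteq> T" if T: "T \<in> triangles V E" for T
  proof -
    obtain x y z where "T = {x, y, z}" "x \<noteq> y" using T by (auto simp: triangles_def card_3_iff)
    then show ?thesis using T by (intro bexI[of _ "{x, y}"]) (auto simp: triangles_def)
  qed
  obtain w r
    where r: "\<And>e. r e = (\<Sum>T\<in>{T \<in> triangles V E. e \<subseteq> T}. w T) - 1"
      and w0: "\<And>T. T \<in> triangles V E \<Longrightarrow> (0::real) \<le> w T"
      and rT: "\<And>T. T \<in> triangles V E \<Longrightarrow> 0 \<le> (\<Sum>e\<in>{e \<in> E. e \<subseteq> T}. r e)"
      and slack: "\<And>T. T \<in> triangles V E \<Longrightarrow> w T * (\<Sum>e\<in>{e \<in> E. e \<subseteq> T}. r e) = 0"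
    by (rule ex_nonneg_least_squares[where inc = "(\<subseteq>)", OF finE fin_tri cov]) (assumption, rule that)
  have "0 \<le> (\<Sum>u\<in>V. \<Sum>v\<in>V. if {u, v} \<in> E then r {u, v} else 0)"
  proof (rule sum_edges_nonneg[OF finV])
    show "{v, v} \<notin> E" for v using card_e[of "{v, v}"] by auto
    show "3 * card V \<le> 4 * card {u \<in> V. {v, u} \<in> E}" if v: "v \<in> V" for v
    proof -
      \<comment> \<open>The vertex \<open>v\<close> makes \<open>V\<close> nonempty, so
        \<open>Min\<close> is meaningful here.\<close>
      have "min_degree V E \<le> vertex_degree E v"
        using finV v by (simp add: min_degree_def)
      also have "vertex_degree E v = card {u \<in> V. {v, u} \<in> E}"
        using sum_incident_edges[OF assms(1), of "\<lambda>_. 1::nat" v] by (simp add: vertex_degree_def)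
      finally show ?thesis using assms(2,3) by linarith
    qed
    show "0 \<le> r {x, y} + r {y, z} + r {x, z}"
      if V: "{x, y, z} \<subseteq> V" and adj: "{x, y} \<in> E" "{y, z} \<in> E" "{x, z} \<in> E" for x y z
    proof -
      have neq: "x \<noteq> y" "y \<noteq> z" "x \<noteq> z" using adj card_e by fastforce+
      then have "{x, y, z} \<in> triangles V E"
        using V adj by (auto simp: triangles_def insert_commute)
      from rT[OF this] show ?thesis
        using neq by (simp add: tri_edges[OF adj] doubleton_eq_iff)
    qed
  qed (simp_all add: insert_commute)
  also have "\<dots> = (\<Sum>u\<in>V. \<Sum>e\<in>{e \<in> E. u \<in> e}. r e)"
    using finV by (simp add: sum_incident_edges[OF assms(1)] sum.inter_filter)
  also have "\<dots> = (\<Sum>e\<in>E. \<Sum>u\<in>{u \<in> V. u \<in> e}. r e)"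
    using finV finE by (rule sum.swap_restrict)
  also have "\<dots> = (\<Sum>e\<in>E. 2 * r e)"
  proof (intro sum.cong refl)
    fix e assume "e \<in> E"
    then have "{u \<in> V. u \<in> e} = e" "card e = 2" using EV card_e by auto
    then show "(\<Sum>u\<in>{u \<in> V. u \<in> e}. r e) = 2 * r e" by simp
  qed
  finally have pos: "0 \<le> (\<Sum>e\<in>E. r e)" by (simp flip: sum_distrib_left)
  \<comment> \<open>Complementary slackness summed over all triangles. The total weight at
    \<open>e\<close> is \<open>1 + r e\<close>, so exchanging the sums gives
    \<open>r e + (r e)\<^sup>2\<close> for each edge, and \<open>pos\<close> then forces all
    residuals to vanish.\<close>
  have "0 = (\<Sum>T\<in>triangles V E. \<Sum>e\<in>{e \<in> E. e \<subseteq> T}. w T * r e)"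
    using slack by (simp add: sum_distrib_left)
  also have "\<dots> = (\<Sum>e\<in>E. \<Sum>T\<in>{T \<in> triangles V E. e \<subseteq> T}. w T * r e)"
    using fin_tri finE by (rule sum.swap_restrict)
  also have "\<dots> = (\<Sum>e\<in>E. r e + (r e)\<^sup>2)"
  proof (intro sum.cong refl)
    fix e
    have "(\<Sum>T\<in>{T \<in> triangles V E. e \<subseteq> T}. w T * r e) = (1 + r e) * r e"
      using r[of e] by (simp flip: sum_distrib_right)
    then show "(\<Sum>T\<in>{T \<in> triangles V E. e \<subseteq> T}. w T * r e) = r e + (r e)\<^sup>2"
      by (simp add: power2_eq_square algebra_simps)
  qed
  finally have "(\<Sum>e\<in>E. (r e)\<^sup>2) \<le> 0" using pos by (simp add: sum.distrib)
  then have "r e = 0" if "e \<in> E" for e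
    using sum_nonneg_eq_0_iff[OF finE, of "\<lambda>e. (r e)\<^sup>2"] that
    by (simp add: order_antisym sum_nonneg)
  then show ?thesis
    using w0 r unfolding fractional_triangle_decomposition_def by (intro exI[of _ w]) auto
qed
end
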